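(* Let $f:\mathbb R^+\to\mathbb R$ be a concave function with $f(0)=0$. The set cover problem with general costs $f$ can be approximated in polynomial time (by the greedy algorithm) within a factor of $$\max\left\{\frac{1}{f(c)}\sum_{j=1}^c\frac{f(j)}{j} \;:\; 1\le c\le\max_i|S_i|\right\},$$ i.e., the algorithm outputs a cover whose cost is at most this factor times the minimum cost.
   Context: An instance consists of an $n$-element ground set $V$ and a collection $\mathcal S=\{S_1,\dots,S_k\}$ of subsets of $V$ whose union is $V$. A cover is a map $\phi:V\to\mathcal S$ with $v\in\phi(v)$ for all $v\in V$; let $c_i:=|\phi^{-1}(S_i)|$. The set cover problem with general costs $f$ asks for a cover minimizing $\sum_{i=1}^k f(c_i)$. The greedy algorithm repeatedly chooses a set $S_i\in\mathcal S$ containing the maximum number of not-yet-covered elements and assigns all those uncovered elements to $S_i$, until every element is assigned.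
   Formalization: The formal statement additionally assumes f(c) > 0 for all integers 1 ≤ c ≤ max|S_i|; otherwise the factor may be undefined (f(c)=0) or the claim false (f(x) = -x² with sets {1..5}, {6..10}, {3..8}: greedy costs -44, the optimum is -50, the factor is 1). *)

theory Defs
  imports "HOL-Analysis.Analysis" "HOL-Computational_Algebra.Polynomial"
begin

section \<open>Set cover with general costs\<close>

text \<open>Finiteness of the collection follows from finiteness of the ground set.\<close>

definition set_cover_instance :: "'a set \<Rightarrow> 'a set set \<Rightarrow> bool" where
  "set_cover_instance V S \<longleftrightarrow> finite V \<and> \<Union>S = V"

text \<open>Maps with domain \<open>V\<close> are extensional functions, so that an instance has finitely many covers.\<close>

definition covers :: "'a set \<Rightarrow> 'a set set \<Rightarrow> ('a \<Rightarrow> 'a set) set" where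
  "covers V S = {\<phi> \<in> V \<rightarrow>\<^sub>E S. \<forall>v\<in>V. v \<in> \<phi> v}"

definition cover_cost :: "(real \<Rightarrow> real) \<Rightarrow> 'a set \<Rightarrow> 'a set set \<Rightarrow> ('a \<Rightarrow> 'a set) \<Rightarrow> real" where
  "cover_cost f V S \<phi> = (\<Sum>A\<in>S. f (real (card {v \<in> V. \<phi> v = A})))"

definition min_cost :: "(real \<Rightarrow> real) \<Rightarrow> 'a set \<Rightarrow> 'a set set \<Rightarrow> real" where
  "min_cost f V S = Min (cover_cost f V S ` covers V S)"

definition max_set_size :: "'a set set \<Rightarrow> nat" where
  "max_set_size S = Max (card ` S)"

definition approx_factor :: "(real \<Rightarrow> real) \<Rightarrow> 'a set set \<Rightarrow> real" where
  "approx_factor f S =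
     Max ((\<lambda>c::nat. 1 / f (real c) * (\<Sum>j=1..c. f (real j) / real j)) ` {1..max_set_size S})"


section \<open>The greedy algorithm\<close>

text \<open>\<open>greedy_reaches V S U \<phi>\<close>: some run of the greedy algorithm, with ties broken arbitrarily,
  arrives at the set \<open>U\<close> of uncovered elements and the assignment \<open>\<phi>\<close> of the covered ones.\<close>

inductive greedy_reaches ::
    "'a set \<Rightarrow> 'a set set \<Rightarrow> 'a set \<Rightarrow> ('a \<Rightarrow> 'a set) \<Rightarrow> bool" for V S where
  start: "greedy_reaches V S V (\<lambda>_. undefined)"
| pick: "greedy_reaches V S (U - A) (\<lambda>v. if v \<in> A \<inter> U then A else \<phi> v)"
    if "greedy_reaches V S U \<phi>" and "U \<noteq> {}"
      and "A \<in> S" and "\<forall>B\<in>S. card (B \<inter> U) \<le> card (A \<inter> U)"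

definition greedy_output :: "'a set \<Rightarrow> 'a set set \<Rightarrow> ('a \<Rightarrow> 'a set) \<Rightarrow> bool" where
  "greedy_output V S \<phi> \<longleftrightarrow> greedy_reaches V S {} \<phi>"


section \<open>A step-counting implementation\<close>

text \<open>A timed value consists of a result and the number of steps used to compute it.  In the
  program below every function call costs one step; constructors, pattern matching, equality tests
  on ground elements and comparisons of counters are free and only occur boundedly often per call.\<close>

type_synonym 'r timed = "'r \<times> nat"

definition ret :: "'r \<Rightarrow> 'r timed" where
  "ret x = (x, 0)"

definition bind_timed :: "'r timed \<Rightarrow> ('r \<Rightarrow> 's timed) \<Rightarrow> 's timed" (infixl "\<then>" 54) where
  "m \<then> g = (fst (g (fst m)), snd m + snd (g (fst m)))"

definition tick :: "'r timed \<Rightarrow> 'r timed" where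
  "tick m = (fst m, Suc (snd m))"

fun member_alg :: "'a \<Rightarrow> 'a list \<Rightarrow> bool timed" where
  "member_alg x [] = tick (ret False)"
| "member_alg x (y # ys) = tick (if x = y then ret True else member_alg x ys)"

text \<open>\<open>count_alg U A\<close> counts the elements of \<open>U\<close> lying in \<open>A\<close>.\<close>

fun count_alg :: "'a list \<Rightarrow> 'a list \<Rightarrow> nat timed" where
  "count_alg [] A = tick (ret 0)"
| "count_alg (u # us) A =
     tick (member_alg u A \<then> (\<lambda>b. count_alg us A \<then> (\<lambda>n. ret (if b then Suc n else n))))"

fun best_alg :: "'a list \<Rightarrow> 'a list list \<Rightarrow> 'a list \<Rightarrow> 'a list timed" where
  "best_alg U [] A = tick (ret A)"
| "best_alg U (B # Bs) A =
     tick (count_alg U A \<then> (\<lambda>m. count_alg U B \<then> (\<lambda>n. best_alg U Bs (if m < n then B else A))))"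

text \<open>\<open>assign_alg A U out\<close> extends \<open>out\<close> by assigning to \<open>A\<close> all elements of \<open>U\<close> in \<open>A\<close>,
  and also returns the remaining elements of \<open>U\<close>.\<close>

fun assign_alg ::
    "'a list \<Rightarrow> 'a list \<Rightarrow> ('a \<times> 'a list) list \<Rightarrow> ('a list \<times> ('a \<times> 'a list) list) timed" where
  "assign_alg A [] out = tick (ret ([], out))"
| "assign_alg A (u # us) out =
     tick (member_alg u A \<then> (\<lambda>b.
       if b then assign_alg A us ((u, A) # out)
       else assign_alg A us out \<then> (\<lambda>(rest, out'). ret (u # rest, out'))))"

text \<open>The second argument only bounds the number of rounds.  On an instance every round covers a
  new element, so that the ground list is long enough.\<close>

fun loop_alg ::
    "'a list list \<Rightarrow> 'a list \<Rightarrow> 'a list \<Rightarrow> ('a \<times> 'a list) list \<Rightarrow> ('a \<times> 'a list) list timed" where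
  "loop_alg Ss [] U out = tick (ret out)"
| "loop_alg Ss (r # rs) U out =
     tick (if U = [] then ret out
           else best_alg U Ss [] \<then> (\<lambda>A.
             assign_alg A U out \<then> (\<lambda>(rest, out'). loop_alg Ss rs rest out')))"

definition greedy_alg :: "'a list \<Rightarrow> 'a list list \<Rightarrow> ('a \<times> 'a list) list timed" where
  "greedy_alg Vs Ss = tick (loop_alg Ss Vs Vs [])"

definition alg_result :: "'a list \<Rightarrow> 'a list list \<Rightarrow> ('a \<times> 'a list) list" where
  "alg_result Vs Ss = fst (greedy_alg Vs Ss)"

definition alg_time :: "'a list \<Rightarrow> 'a list list \<Rightarrow> nat" where
  "alg_time Vs Ss = snd (greedy_alg Vs Ss)"

text \<open>Input encoding: sets are duplicate-free lists, and every set is listed once.\<close>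

definition encodes :: "'a list \<Rightarrow> 'a list list \<Rightarrow> 'a set \<Rightarrow> 'a set set \<Rightarrow> bool" where
  "encodes Vs Ss V S \<longleftrightarrow>
     distinct Vs \<and> set Vs = V \<and>
     (\<forall>A\<in>set Ss. distinct A) \<and> distinct (map set Ss) \<and> set (map set Ss) = S"

text \<open>The map \<open>V \<rightarrow> S\<close> given by an output list; elements without an entry get \<open>undefined\<close>.\<close>

definition decode :: "('a \<times> 'a list) list \<Rightarrow> 'a \<Rightarrow> 'a set" where
  "decode out v = (case map_of out v of Some A \<Rightarrow> set A | None \<Rightarrow> undefined)"

end

theory Submission
  imports Defs
begin

text \<open>Charge every element \<open>v\<close> the amount \<open>f c / c\<close>, where \<open>c\<close> is the number of elements covered
  in the same greedy round; the charges add up to the greedy cost.  Concavity and \<open>f 0 = 0\<close> make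
  \<open>f c / c\<close> nonincreasing.  Let an optimal cover assign a set \<open>T\<close> of \<open>c\<close> elements to one member of
  the collection.  While \<open>j\<close> elements of \<open>T\<close> are uncovered, the greedy choice covers at least \<open>j\<close>
  elements, so an element of \<open>T\<close> covered in that round is charged at most \<open>f j / j\<close>.  Hence \<open>T\<close> is
  charged at most the sum of \<open>f j / j\<close> over \<open>1 \<le> j \<le> c\<close>, which is at most the factor times
  \<open>f c\<close>.\<close>

section \<open>The approximation guarantee\<close>

text \<open>\<open>x\<close> is the convex combination of \<open>0\<close> and \<open>y\<close> with
  weight \<open>x / y\<close> on \<open>y\<close>, so concavity gives \<open>f x\<close> at least
  \<open>x / y * f y\<close>.\<close>

lemma concave_ratio_antimono:
  fixes f :: "real \<Rightarrow> real"
  assumes "concave_on {0..} f" "f 0 = 0" "0 < x" "x \<le> y"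
  shows "f y / y \<le> f x / x"
proof -
  have "f ((1 - x / y) *\<^sub>R 0 + (x / y) *\<^sub>R y) \<ge> (1 - x / y) * f 0 + (x / y) * f y"
    using assms by (intro concave_onD[OF assms(1)]) auto
  then have "f x \<ge> x / y * f y"
    using assms by simp
  then show ?thesis
    using assms by (simp add: field_simps)
qed

lemma sum_greaterThanAtMost_ge:
  fixes g :: "nat \<Rightarrow> real"
  assumes "m \<le> n" and "\<And>j. m < j \<Longrightarrow> j \<le> n \<Longrightarrow> b \<le> g j"
  shows "real (n - m) * b \<le> (\<Sum>j\<in>{m<..n}. g j)"
  using sum_bounded_below[of "{m<..n}" b g] assms by simp

lemma set_cover_instance_finite:
  assumes "set_cover_instance V S"
  shows "finite V" "finite S" "A \<in> S \<Longrightarrow> A \<subseteq> V" "A \<in> S \<Longrightarrow> finite A"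
proof -
  show V: "finite V" and sub: "A \<in> S \<Longrightarrow> A \<subseteq> V" for A
    using assms by (auto simp: set_cover_instance_def)
  then have "S \<subseteq> Pow V" by blast
  with V show "finite S" by (meson finite_Pow_iff finite_subset)
  show "A \<in> S \<Longrightarrow> finite A" using V sub finite_subset by blast
qed

text \<open>The elements covered together with \<open>v\<close>.  Uncovered elements have to be excluded, because
  their image \<open>undefined\<close> might be a member of the collection.\<close>

definition round_mates :: "'a set \<Rightarrow> 'a set \<Rightarrow> ('a \<Rightarrow> 'a set) \<Rightarrow> 'a \<Rightarrow> 'a set" where
  "round_mates V U \<phi> v = {w \<in> V - U. \<phi> w = \<phi> v}"

section \<open>Invariants and progress of greedy runs\<close>

text \<open>Induction over the run. Disjointness of used sets from \<open>U\<close> is what later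
  shows that no set is picked twice; the last clause gives extensionality.\<close>

lemma greedy_reaches_assignment:
  assumes "greedy_reaches V S U \<phi>"
  shows "U \<subseteq> V" "v \<in> V - U \<Longrightarrow> \<phi> v \<in> S \<and> v \<in> \<phi> v \<and> \<phi> v \<inter> U = {}"
    "v \<notin> V - U \<Longrightarrow> \<phi> v = undefined"
proof -
  have "U \<subseteq> V \<and> (\<forall>v\<in>V - U. \<phi> v \<in> S \<and> v \<in> \<phi> v \<and> \<phi> v \<inter> U = {}) \<and>
      (\<forall>v. v \<notin> V - U \<longrightarrow> \<phi> v = undefined)"
    using assms
  proof induction
    case (pick U \<phi> A)
    then show ?case by (auto; blast)
  qed simp
  then show "U \<subseteq> V" "v \<in> V - U \<Longrightarrow> \<phi> v \<in> S \<and> v \<in> \<phi> v \<and> \<phi> v \<inter> U = {}"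
    "v \<notin> V - U \<Longrightarrow> \<phi> v = undefined" by blast+
qed

lemma greedy_output_covers:
  assumes "greedy_output V S \<phi>"
  shows "\<phi> \<in> covers V S"
  using greedy_reaches_assignment[of V S "{}" \<phi>] assms
  unfolding greedy_output_def covers_def by (auto simp: PiE_iff extensional_def)

text \<open>Some member of \<open>S\<close> contains an element of \<open>U\<close>, and
  \<open>A\<close> covers at least as many. Since \<open>A\<close> is an arbitrary set, this also
  rules out the initial candidate \<open>[]\<close> of \<open>best_alg\<close>.\<close>

lemma greedy_choice_nonempty:
  assumes "set_cover_instance V S" "U \<subseteq> V" "U \<noteq> {}" "\<forall>B\<in>S. card (B \<inter> U) \<le> card (A \<inter> U)"
  shows "A \<inter> U \<noteq> {}"
proof
  assume e: "A \<inter> U = {}"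
  obtain u B where uB: "u \<in> U" "u \<in> B" "B \<in> S"
    using assms unfolding set_cover_instance_def by blast
  have "finite (B \<inter> U)"
    using uB set_cover_instance_finite[OF assms(1)] by blast
  then have "card (B \<inter> U) > 0"
    using uB by (auto simp: card_gt_0_iff)
  then show False using assms(4) uB e by fastforce
qed

text \<open>Induction over the run: a round that shrinks \<open>T \<inter> U\<close> from
  \<open>n\<close> to \<open>m\<close> elements pays for the indices in \<open>{m<..n}\<close>, and
  these intervals join up to the stated one.\<close>

lemma greedy_charge_bound:
  fixes g :: "nat \<Rightarrow> real"
  assumes inst: "set_cover_instance V S"
    and anti: "\<And>i j. 1 \<le> i \<Longrightarrow> i \<le> j \<Longrightarrow> g j \<le> g i"
    and "greedy_reaches V S U \<phi>" and B: "B \<in> S" and T: "T \<subseteq> B"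
  shows "(\<Sum>v\<in>T - U. g (card (round_mates V U \<phi> v))) \<le> (\<Sum>j\<in>{card (T \<inter> U)<..card T}. g j)"
  using assms(3)
proof induction
  case start
  have "T \<subseteq> V" using B T set_cover_instance_finite[OF inst] by blast
  then have "T - V = {}" "T \<inter> V = T" by auto
  then show ?case by (simp only:) simp
next
  case (pick U \<phi> A)
  let ?\<phi>' = "\<lambda>v. if v \<in> A \<inter> U then A else \<phi> v"
  note inv = greedy_reaches_assignment[OF pick.hyps(1)]
  have finV: "finite V" and TV: "T \<subseteq> V" and AV: "A \<subseteq> V"
    using B T pick.hyps(3) set_cover_instance_finite[OF inst] by blast+
  have finT: "finite T" using TV finV finite_subset by blast
  have finU: "finite U" using inv(1) finV finite_subset by blast
  have AU: "A \<inter> U \<noteq> {}"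
    using greedy_choice_nonempty[OF inst inv(1) pick.hyps(2,4)] .
  \<comment> \<open>Sets used earlier avoid \<open>U\<close>, but \<open>A\<close> meets it. So
    \<open>A\<close> is new, and earlier charges stay unchanged.\<close>
  have notA: "\<phi> v \<noteq> A" if "v \<in> V - U" for v
    using inv(2)[OF that] AU by auto
  have old: "round_mates V (U - A) ?\<phi>' v = round_mates V U \<phi> v" if "v \<in> T - U" for v
    using that TV notA unfolding round_mates_def by (auto split: if_splits)
  have new: "round_mates V (U - A) ?\<phi>' v = A \<inter> U" if "v \<in> T \<inter> U \<inter> A" for v
    using that notA AV unfolding round_mates_def by (auto split: if_splits)
  let ?m = "card (T \<inter> (U - A))" and ?n = "card (T \<inter> U)"
  have split: "T - (U - A) = (T - U) \<union> (T \<inter> U \<inter> A)" by auto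
  have mn: "?m \<le> ?n" using finT by (intro card_mono) auto
  have "card (T \<inter> U) = card (T \<inter> (U - A) \<union> T \<inter> U \<inter> A)"
    by (rule arg_cong[where f = card]) auto
  also have "\<dots> = ?m + card (T \<inter> U \<inter> A)"
    using finT by (intro card_Un_disjoint) auto
  finally have d: "card (T \<inter> U \<inter> A) = ?n - ?m" by simp
  \<comment> \<open>\<open>B\<close> was available to the greedy rule, so the round covers at least
    \<open>?n\<close> elements and its charge is at most \<open>g j\<close> for every positive
    \<open>j \<le> ?n\<close>.\<close>
  have "?n \<le> card (B \<inter> U)" using T finU by (intro card_mono) auto
  also have "\<dots> \<le> card (A \<inter> U)" using pick.hyps(4) B by blast
  finally have le: "?n \<le> card (A \<inter> U)" .
  have "(\<Sum>v\<in>T - (U - A). g (card (round_mates V (U - A) ?\<phi>' v)))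
     = (\<Sum>v\<in>T - U. g (card (round_mates V (U - A) ?\<phi>' v)))
       + (\<Sum>v\<in>T \<inter> U \<inter> A. g (card (round_mates V (U - A) ?\<phi>' v)))"
    unfolding split using finT by (intro sum.union_disjoint) auto
  also have "\<dots> = (\<Sum>v\<in>T - U. g (card (round_mates V U \<phi> v)))
       + (\<Sum>v\<in>T \<inter> U \<inter> A. g (card (A \<inter> U)))"
    using old new by (intro arg_cong2[where f = "(+)"] sum.cong) simp_all
  also have "\<dots> = (\<Sum>v\<in>T - U. g (card (round_mates V U \<phi> v))) + real (?n - ?m) * g (card (A \<inter> U))"
    by (simp add: d)
  also have "\<dots> \<le> (\<Sum>j\<in>{?n<..card T}. g j) + (\<Sum>j\<in>{?m<..?n}. g j)"
    using mn le by (intro add_mono pick.IH sum_greaterThanAtMost_ge anti) auto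
  also have "\<dots> = (\<Sum>j\<in>{?m<..?n} \<union> {?n<..card T}. g j)"
    by (subst sum.union_disjoint) auto
  also have "{?m<..?n} \<union> {?n<..card T} = {?m<..card T}"
    using mn card_mono[OF finT, of "T \<inter> U"] by auto
  finally show ?case .
qed

section \<open>From charges to the cost of a cover\<close>

text \<open>The fibres of \<open>\<phi>\<close> partition \<open>V\<close>, and a fibre of size
  \<open>c > 0\<close> contributes \<open>c\<close> times \<open>f c / c\<close>. Empty fibres cost
  nothing because \<open>f 0 = 0\<close>.\<close>

lemma cover_cost_eq_sum_charges:
  assumes "set_cover_instance V S" "\<phi> \<in> covers V S" "f 0 = 0"
  shows "cover_cost f V S \<phi> =
    (\<Sum>v\<in>V. f (real (card (round_mates V {} \<phi> v))) / real (card (round_mates V {} \<phi> v)))"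
proof -
  let ?g = "\<lambda>v. f (real (card (round_mates V {} \<phi> v))) / real (card (round_mates V {} \<phi> v))"
  note fin = set_cover_instance_finite[OF assms(1)]
  have "f (real (card {v \<in> V. \<phi> v = A})) = sum ?g {v \<in> V. \<phi> v = A}" for A
  proof -
    let ?c = "card {v \<in> V. \<phi> v = A}"
    have "sum ?g {v \<in> V. \<phi> v = A} = (\<Sum>v\<in>{v \<in> V. \<phi> v = A}. f (real ?c) / real ?c)"
      by (intro sum.cong) (auto simp: round_mates_def)
    also have "\<dots> = f (real ?c)" using assms(3) by (cases "?c = 0") auto
    finally show ?thesis by simp
  qed
  then have "cover_cost f V S \<phi> = (\<Sum>A\<in>S. sum ?g {v \<in> V. \<phi> v = A})"
    by (simp add: cover_cost_def)
  also have "\<dots> = sum ?g V"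
    using fin assms(2) by (intro sum.group) (auto simp: covers_def)
  finally show ?thesis .
qed

text \<open>\<open>card T\<close> is one of the indices of the maximum, and positivity of
  \<open>f\<close> there allows clearing the denominator. Empty \<open>T\<close> lies outside the
  index range, but both sides are then zero.\<close>

lemma sum_ratio_le_approx_factor:
  assumes "set_cover_instance V S" "A \<in> S" "T \<subseteq> A" "f 0 = 0"
    and pos: "\<forall>c\<in>{1..max_set_size S}. f (real c) > 0"
  shows "(\<Sum>j=1..card T. f (real j) / real j) \<le> approx_factor f S * f (real (card T))"
proof (cases "card T = 0")
  case False
  note fin = set_cover_instance_finite[OF assms(1)]
  have "card T \<le> card A" using fin assms by (intro card_mono) auto
  also have "\<dots> \<le> max_set_size S"
    unfolding max_set_size_def using fin assms by (intro Max_ge) auto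
  finally have c: "card T \<in> {1..max_set_size S}" using False by simp
  have "1 / f (real (card T)) * (\<Sum>j=1..card T. f (real j) / real j) \<le> approx_factor f S"
    unfolding approx_factor_def using c by (intro Max_ge) auto
  with pos c show ?thesis by (simp add: field_simps)
qed (simp add: assms(4))

lemma finite_covers:
  assumes "set_cover_instance V S"
  shows "finite (covers V S)"
proof -
  have "finite (V \<rightarrow>\<^sub>E S)"
    using set_cover_instance_finite[OF assms] by (intro finite_PiE) auto
  then show ?thesis by (simp add: covers_def)
qed

lemma greedy_cost_le_cover_cost:
  assumes conc: "concave_on {0..} f" and f0: "f 0 = 0"
    and inst: "set_cover_instance V S"
    and pos: "\<forall>c\<in>{1..max_set_size S}. f (real c) > 0"
    and out: "greedy_output V S \<phi>" and \<psi>: "\<psi> \<in> covers V S"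
  shows "cover_cost f V S \<phi> \<le> approx_factor f S * cover_cost f V S \<psi>"
proof -
  let ?g = "\<lambda>c::nat. f (real c) / real c"
  let ?T = "\<lambda>A. {v \<in> V. \<psi> v = A}"
  note fin = set_cover_instance_finite[OF inst]
  have "cover_cost f V S \<phi> = (\<Sum>v\<in>V. ?g (card (round_mates V {} \<phi> v)))"
    by (rule cover_cost_eq_sum_charges[of V S \<phi> f, OF inst greedy_output_covers[OF out] f0])
  \<comment> \<open>The charges come from \<open>\<phi>\<close> but are regrouped along the fibres
    of the competing cover \<open>\<psi>\<close>.\<close>
  also have "\<dots> = (\<Sum>A\<in>S. \<Sum>v\<in>?T A. ?g (card (round_mates V {} \<phi> v)))"
    using fin \<psi> by (intro sum.group[symmetric]) (auto simp: covers_def)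
  also have "\<dots> \<le> (\<Sum>A\<in>S. approx_factor f S * f (real (card (?T A))))"
  proof (rule sum_mono)
    fix A assume A: "A \<in> S"
    have TA: "?T A \<subseteq> A" using \<psi> by (auto simp: covers_def)
    have "(\<Sum>v\<in>?T A - {}. ?g (card (round_mates V {} \<phi> v))) \<le> sum ?g {card (?T A \<inter> {})<..card (?T A)}"
      using out A TA unfolding greedy_output_def
      by (intro greedy_charge_bound[OF inst] concave_ratio_antimono[OF conc f0]) auto
    also have "{card (?T A \<inter> {})<..card (?T A)} = {1..card (?T A)}" by auto
    also have "sum ?g \<dots> \<le> approx_factor f S * f (real (card (?T A)))"
      using sum_ratio_le_approx_factor[of V S A, OF inst A TA f0 pos] .
    finally show "(\<Sum>v\<in>?T A. ?g (card (round_mates V {} \<phi> v)))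
      \<le> approx_factor f S * f (real (card (?T A)))" by simp
  qed
  also have "\<dots> = approx_factor f S * cover_cost f V S \<psi>"
    by (simp add: cover_cost_def sum_distrib_left)
  finally show ?thesis .
qed

lemma greedy_cost_le_min_cost:
  assumes "concave_on {0..} f" "f 0 = 0" "set_cover_instance V S"
    and "\<forall>c\<in>{1..max_set_size S}. f (real c) > 0" and "greedy_output V S \<phi>"
  shows "cover_cost f V S \<phi> \<le> approx_factor f S * min_cost f V S"
proof -
  \<comment> \<open>The minimum is attained: there are finitely many covers, and the greedy output
    is one.\<close>
  have "min_cost f V S \<in> cover_cost f V S ` covers V S"
    unfolding min_cost_def
    using finite_covers[OF assms(3)] greedy_output_covers[OF assms(5)] by (intro Min_in) auto
  then show ?thesis using greedy_cost_le_cover_cost[OF assms] by auto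
qed


section \<open>The implementation\<close>

lemmas timed_simps = ret_def bind_timed_def tick_def

section \<open>Results and step counts of the subroutines\<close>

lemma member_alg_result: "fst (member_alg x ys) \<longleftrightarrow> x \<in> set ys"
  by (induction ys) (auto simp: timed_simps)

lemma member_alg_time: "snd (member_alg x ys) \<le> length ys + 1"
  by (induction ys) (auto simp: timed_simps)

lemma count_alg_result: "distinct us \<Longrightarrow> fst (count_alg us A) = card (set A \<inter> set us)"
  by (induction us) (auto simp: timed_simps member_alg_result)

lemma count_alg_time: "snd (count_alg us A) \<le> length us * (length A + 2) + 1"
proof (induction us)
  case (Cons u us)
  then show ?case using member_alg_time[of u A] by (simp add: timed_simps)
qed (simp add: timed_simps)

lemma best_alg_mem: "fst (best_alg U Bs A) \<in> insert A (set Bs)"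
  by (induction Bs arbitrary: A) (auto simp: timed_simps)

text \<open>The candidate is replaced only by a strictly better one. \<open>A\<close> must vary in
  the induction, since either \<open>A\<close> or \<open>B\<close> is passed on.\<close>

lemma best_alg_maximal:
  assumes "distinct U"
  shows "\<forall>B\<in>insert A (set Bs). card (set B \<inter> set U) \<le> card (set (fst (best_alg U Bs A)) \<inter> set U)"
proof (induction Bs arbitrary: A)
  case (Cons B Bs)
  show ?case
    using Cons[of A] Cons[of B] by (auto simp: timed_simps count_alg_result[OF assms])
qed (simp add: timed_simps)

text \<open>Each list in \<open>Bs\<close> costs two counts of at most
  \<open>n * (n + 2) + 1\<close> steps and one step for the call.\<close>

lemma best_alg_time:
  assumes "length U \<le> n" "\<forall>B\<in>insert A (set Bs). length B \<le> n"
  shows "snd (best_alg U Bs A) \<le> length Bs * (2 * (n * (n + 2) + 1) + 1) + 1"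
  using assms(2)
proof (induction Bs arbitrary: A)
  case (Cons B Bs)
  have count: "snd (count_alg U C) \<le> n * (n + 2) + 1" if "length C \<le> n" for C
  proof -
    have "length U * (length C + 2) \<le> n * (n + 2)"
      using assms(1) that by (intro mult_le_mono) auto
    then show ?thesis using count_alg_time[of U C] by linarith
  qed
  define A' where "A' = (if fst (count_alg U A) < fst (count_alg U B) then B else A)"
  have "snd (best_alg U Bs A') \<le> length Bs * (2 * (n * (n + 2) + 1) + 1) + 1"
    using Cons.prems by (intro Cons.IH) (auto simp: A'_def)
  moreover have "snd (best_alg U (B # Bs) A) =
      Suc (snd (count_alg U A) + (snd (count_alg U B) + snd (best_alg U Bs A')))"
    by (simp add: timed_simps A'_def)
  ultimately show ?case
    using count[of A] count[of B] Cons.prems by simp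
qed (simp add: timed_simps)

lemma assign_alg_rest:
  "fst (fst (assign_alg A us out)) = filter (\<lambda>u. u \<notin> set A) us"
  by (induction us arbitrary: out) (auto simp: timed_simps member_alg_result case_prod_beta)

text \<open>New entries are put in front and shadow older ones in \<open>map_of\<close>. The
  right-hand side has the shape of the update in \<open>greedy_reaches.pick\<close>.\<close>

lemma assign_alg_decode:
  "decode (snd (fst (assign_alg A us out))) =
    (\<lambda>v. if v \<in> set A \<inter> set us then set A else decode out v)"
proof (induction us arbitrary: out)
  case (Cons u us)
  have "decode ((u, A) # out) = (decode out)(u := set A)"
    by (simp add: decode_def fun_eq_iff)
  then show ?case
    by (auto simp: timed_simps member_alg_result Cons case_prod_beta fun_eq_iff)
qed (simp add: timed_simps)

lemma assign_alg_time: "snd (assign_alg A us out) \<le> length us * (length A + 2) + 1"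
proof (induction us arbitrary: out)
  case (Cons u us)
  show ?case
    using Cons[of out] Cons[of "(u, A) # out"] member_alg_time[of u A]
    by (auto simp: timed_simps split: prod.splits)
qed (simp add: timed_simps)

lemma encodes_lengths:
  assumes "set_cover_instance V S" "encodes Vs Ss V S"
  shows "length Vs = card V" "length Ss = card S" "B \<in> set Ss \<Longrightarrow> length B \<le> card V"
proof -
  show "length Vs = card V" using assms(2) by (auto simp: encodes_def distinct_card)
  show "length Ss = card S"
    using assms(2) distinct_card[of "map set Ss"] by (auto simp: encodes_def)
  assume B: "B \<in> set Ss"
  then have "length B = card (set B)" using assms(2) by (auto simp: encodes_def distinct_card)
  also have "\<dots> \<le> card V"
    using B assms by (intro card_mono) (auto simp: encodes_def set_cover_instance_def)
  finally show "length B \<le> card V" .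
qed

section \<open>The main loop\<close>

lemma best_alg_greedy_choice:
  assumes inst: "set_cover_instance V S" and enc: "encodes Vs Ss V S"
    and U: "distinct U" "set U \<subseteq> V" "U \<noteq> []"
  shows "fst (best_alg U Ss []) \<in> set Ss"
    and "\<forall>B\<in>S. card (B \<inter> set U) \<le> card (set (fst (best_alg U Ss [])) \<inter> set U)"
proof -
  let ?A = "fst (best_alg U Ss [])"
  have S: "S = set ` set Ss" using enc by (auto simp: encodes_def)
  show max: "\<forall>B\<in>S. card (B \<inter> set U) \<le> card (set ?A \<inter> set U)"
    using best_alg_maximal[OF U(1), of "[]" Ss] by (auto simp: S)
  \<comment> \<open>The search starts from \<open>[]\<close>, which need not encode a member of
    \<open>S\<close>. A maximal choice meets \<open>U\<close>, so the result is not this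
    default.\<close>
  have "set ?A \<inter> set U \<noteq> {}"
    using greedy_choice_nonempty[OF inst U(2) _ max] U(3) by simp
  then have "?A \<noteq> []" by auto
  then show "?A \<in> set Ss" using best_alg_mem[of U Ss "[]"] by blast
qed

lemma loop_alg_round:
  fixes Ss :: "'a list list" and U :: "'a list" and out :: "('a \<times> 'a list) list"
  assumes "U \<noteq> []"
  defines "A \<equiv> fst (best_alg U Ss [])"
  defines "out' \<equiv> snd (fst (assign_alg A U out))"
  defines "rest \<equiv> filter (\<lambda>u. u \<notin> set A) U"
  shows "fst (loop_alg Ss (r # rs) U out) = fst (loop_alg Ss rs rest out')"
    and "snd (loop_alg Ss (r # rs) U out) = Suc (snd (best_alg U Ss []) +
      (snd (assign_alg A U out) + snd (loop_alg Ss rs rest out')))"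
  using assms(1) assign_alg_rest[of A U out]
  by (auto simp: timed_simps A_def out'_def rest_def split: prod.splits)

text \<open>The remaining list and the decoded output always form a reachable greedy state. As each
  round shortens \<open>U\<close>, the bound by \<open>length rs\<close> persists, so
  \<open>U\<close> is empty once \<open>rs\<close> runs out.\<close>

lemma loop_alg_greedy:
  assumes inst: "set_cover_instance V S" and enc: "encodes Vs Ss V S"
    and "greedy_reaches V S (set U) (decode out)" "distinct U" "length U \<le> length rs"
  shows "greedy_output V S (decode (fst (loop_alg Ss rs U out)))"
  using assms(3-)
proof (induction rs arbitrary: U out)
  case (Cons r rs)
  show ?case
  proof (cases "U = []")
    case False
    let ?A = "fst (best_alg U Ss [])"
    let ?rest = "filter (\<lambda>u. u \<notin> set ?A) U"
    let ?out = "snd (fst (assign_alg ?A U out))"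
    note UV = greedy_reaches_assignment(1)[OF Cons.prems(1)]
    note choice = best_alg_greedy_choice[OF inst enc Cons.prems(2) UV False]
    have AS: "set ?A \<in> S" using choice(1) enc by (auto simp: encodes_def)
    have reach: "greedy_reaches V S (set ?rest) (decode ?out)"
      using greedy_reaches.pick[OF Cons.prems(1) _ AS choice(2)] False
      by (simp add: assign_alg_decode set_diff_eq)
    have "set ?A \<inter> set U \<noteq> {}"
      using greedy_choice_nonempty[OF inst UV _ choice(2)] False by simp
    then obtain u where "u \<in> set U" "u \<in> set ?A" by blast
    then have "length ?rest < length U" by (intro length_filter_less[of u]) auto
    then have "greedy_output V S (decode (fst (loop_alg Ss rs ?rest ?out)))"
      using Cons.prems reach by (intro Cons.IH) auto
    then show ?thesis using loop_alg_round(1)[OF False] by simp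
  qed (use Cons.prems in \<open>simp add: timed_simps greedy_output_def\<close>)
qed (simp add: timed_simps greedy_output_def)

text \<open>One round is a search, an assignment and the call itself; their additive ones give the
  \<open>3\<close>. The final \<open>1\<close> is the terminating call.\<close>

lemma loop_alg_time:
  assumes inst: "set_cover_instance V S" and enc: "encodes Vs Ss V S"
    and n: "n = card V" and k: "k = card S" and "length U \<le> n"
  shows "snd (loop_alg Ss rs U out) \<le>
    length rs * (k * (2 * (n * (n + 2) + 1) + 1) + n * (n + 2) + 3) + 1"
  using assms(5)
proof (induction rs arbitrary: U out)
  case (Cons r rs)
  show ?case
  proof (cases "U = []")
    case False
    let ?A = "fst (best_alg U Ss [])"
    let ?rest = "filter (\<lambda>u. u \<notin> set ?A) U"
    let ?out = "snd (fst (assign_alg ?A U out))"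
    note len = encodes_lengths[OF inst enc]
    have "snd (best_alg U Ss []) \<le> k * (2 * (n * (n + 2) + 1) + 1) + 1"
      using best_alg_time[of U n "[]" Ss] len Cons.prems n k by auto
    moreover have "snd (assign_alg ?A U out) \<le> n * (n + 2) + 1"
    proof -
      \<comment> \<open>Here the default \<open>[]\<close> is not excluded, but its length is
        zero.\<close>
      have "length ?A \<le> n"
        using best_alg_mem[of U Ss "[]"] len(3) n by (cases "?A = []") auto
      then have "length U * (length ?A + 2) \<le> n * (n + 2)"
        using Cons.prems by (intro mult_le_mono) auto
      then show ?thesis using assign_alg_time[of ?A U out] by linarith
    qed
    moreover have "length ?rest \<le> n"
      using Cons.prems length_filter_le order_trans by blast
    note Cons.IH[OF this, of ?out]
    ultimately show ?thesis
      unfolding loop_alg_round(2)[OF False] by simp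
  qed (simp add: timed_simps)
qed (simp add: timed_simps)

lemma decode_Nil: "decode [] = (\<lambda>_. undefined)"
  by (simp add: decode_def fun_eq_iff)

lemma greedy_alg_correct:
  assumes "set_cover_instance V S" "encodes Vs Ss V S"
  shows "greedy_output V S (decode (alg_result Vs Ss))"
proof -
  have "greedy_reaches V S (set Vs) (decode [])" and "distinct Vs"
    using assms(2) greedy_reaches.start[of V S] by (auto simp: encodes_def decode_Nil)
  then have "greedy_output V S (decode (fst (loop_alg Ss Vs Vs [])))"
    by (intro loop_alg_greedy[OF assms]) auto
  then show ?thesis by (simp add: alg_result_def greedy_alg_def tick_def)
qed

text \<open>The loop bound with both \<open>n\<close> and \<open>k\<close> replaced by their sum
  \<open>X\<close>; the \<open>2\<close> adds the outer call to the terminating one.\<close>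

definition greedy_time_poly :: "nat poly" where
  "greedy_time_poly = (let X = [:0, 1:] in
    X * (X * (2 * (X * (X + 2) + 1) + 1) + X * (X + 2) + 3) + 2)"

lemma poly_greedy_time_poly:
  "poly greedy_time_poly N = N * (N * (2 * (N * (N + 2) + 1) + 1) + N * (N + 2) + 3) + 2"
  by (simp add: greedy_time_poly_def Let_def algebra_simps)

lemma greedy_alg_time:
  assumes "set_cover_instance V S" "encodes Vs Ss V S"
  shows "alg_time Vs Ss \<le> poly greedy_time_poly (card V + card S)"
proof -
  let ?n = "card V" and ?k = "card S"
  let ?N = "?n + ?k"
  have "alg_time Vs Ss = Suc (snd (loop_alg Ss Vs Vs []))"
    by (simp add: alg_time_def greedy_alg_def tick_def)
  also have "\<dots> \<le> Suc (?n * (?k * (2 * (?n * (?n + 2) + 1) + 1) + ?n * (?n + 2) + 3) + 1)"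
    using loop_alg_time[OF assms refl refl, of Vs Vs "[]"] encodes_lengths(1)[OF assms] by simp
  also have "\<dots> \<le> Suc (?N * (?N * (2 * (?N * (?N + 2) + 1) + 1) + ?N * (?N + 2) + 3) + 1)"
    by (intro Suc_le_mono[THEN iffD2] add_mono mult_le_mono order_refl) simp_all
  also have "\<dots> = poly greedy_time_poly ?N"
    by (simp add: poly_greedy_time_poly)
  finally show ?thesis .
qed

text \<open>The cost bound holds for every tie-breaking, hence also for the run computed by
  \<open>greedy_alg\<close>; \<open>greedy_time_poly\<close> is the witness for
  \<open>p\<close>.\<close>

theorem theorem8:
  fixes f :: "real \<Rightarrow> real"
  assumes "concave_on {0..} f" and "f 0 = 0"
  shows "(\<forall>(V :: 'a set) S \<phi>.
            set_cover_instance V S \<longrightarrow>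
            (\<forall>c\<in>{1..max_set_size S}. f (real c) > 0) \<longrightarrow>
            greedy_output V S \<phi> \<longrightarrow>
              \<phi> \<in> covers V S \<and> cover_cost f V S \<phi> \<le> approx_factor f S * min_cost f V S) \<and>
         (\<exists>p :: nat poly. \<forall>(V :: 'a set) S Vs Ss.
            set_cover_instance V S \<longrightarrow> encodes Vs Ss V S \<longrightarrow>
              greedy_output V S (decode (alg_result Vs Ss)) \<and>
              alg_time Vs Ss \<le> poly p (card V + card S))"
  using greedy_output_covers greedy_cost_le_min_cost[OF assms] greedy_alg_correct greedy_alg_time
  by blast

end
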